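(* Let $\beta\in(0,1)$ and let $\lambda=\{\lambda_n\}_{n\ge1}$ be a non-decreasing sequence of real numbers with $\lambda_n>0$ for all $n$. For $n\in\mathbb{N}$ put $$w_n(\lambda,\beta)=\frac1{\lambda_n}+\frac1{\lambda_{n+1}}-\frac1{\lambda_n}\Big(1-\frac1n\Big)^{\beta}-\frac1{\lambda_{n+1}}\Big(1+\frac1n\Big)^{\beta}.$$ Then for every sequence $A=(A_n)_{n\ge0}\in C_c(\mathbb{N}_0)$ of real or complex numbers with $A_0=0$ and $A$ not identically zero, $$\sum_{n=1}^{\infty}\Big(\frac1{\lambda_n}+\frac1{\lambda_{n+1}}\Big)\frac{\beta(1-\beta)}{2n^2}|A_n|^2<\sum_{n=1}^{\infty}w_n(\lambda,\beta)|A_n|^2\le\sum_{n=1}^{\infty}\frac{|A_n-A_{n-1}|^2}{\lambda_n}.$$ Moreover, if in addition $\lambda_n\ge1$ for all $n\in\mathbb{N}$ and $\beta\in(0,\tfrac12]$, then the weight sequence $w_n(\lambda,\beta)$ is optimal.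
   Context: $\mathbb{N}=\{1,2,3,\dots\}$, $\mathbb{N}_0=\{0,1,2,\dots\}$, and $C_c(\mathbb{N}_0)$ is the space of finitely supported functions (sequences) on $\mathbb{N}_0$. The weight sequence $w=\{w_n\}$ is called optimal if, whenever $\widetilde w=\{\widetilde w_n\}_{n\ge1}$ is a real sequence with $\widetilde w_n\ge w_n$ for all $n\in\mathbb{N}$ such that $\sum_{n\ge1}\widetilde w_n|A_n|^2\le\sum_{n\ge1}|A_n-A_{n-1}|^2/\lambda_n$ holds for all $A\in C_c(\mathbb{N}_0)$ with $A_0=0$, one has $\widetilde w_n=w_n$ for all $n\in\mathbb{N}$. *)

theory Defs
  imports "HOL-Analysis.Analysis"
begin

text \<open>Sequences indexed by the positive integers are functions on \<open>nat\<close> whose value at 0 is never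
  used.  For finitely supported \<open>A\<close> all infinite sums below have only finitely many nonzero terms.
  The scalar type \<open>'a\<close> is used at \<open>real\<close> and \<open>complex\<close>.\<close>

definition Cc :: "(nat \<Rightarrow> 'a::zero) set" where
  "Cc = {A. finite {n. A n \<noteq> 0}}"

definition weighted_sum :: "(nat \<Rightarrow> real) \<Rightarrow> (nat \<Rightarrow> 'a::real_normed_field) \<Rightarrow> real" where
  "weighted_sum v A = (\<Sum>\<^sub>\<infinity>n\<in>{1..}. v n * (norm (A n))\<^sup>2)"

definition energy :: "(nat \<Rightarrow> real) \<Rightarrow> (nat \<Rightarrow> 'a::real_normed_field) \<Rightarrow> real" where
  "energy lam A = (\<Sum>\<^sub>\<infinity>n\<in>{1..}. (norm (A n - A (n - 1)))\<^sup>2 / lam n)"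

text \<open>At \<open>n = 1\<close> the first power is \<open>0 powr \<beta> = 0\<close>, as it should be for \<open>\<beta> > 0\<close>.\<close>

definition hardy_weight :: "(nat \<Rightarrow> real) \<Rightarrow> real \<Rightarrow> nat \<Rightarrow> real" where
  "hardy_weight lam \<beta> n =
     1 / lam n + 1 / lam (n + 1)
     - 1 / lam n * (1 - 1 / real n) powr \<beta>
     - 1 / lam (n + 1) * (1 + 1 / real n) powr \<beta>"

definition optimal_weight ::
  "'a::real_normed_field itself \<Rightarrow> (nat \<Rightarrow> real) \<Rightarrow> (nat \<Rightarrow> real) \<Rightarrow> bool" where
  "optimal_weight _ lam w \<longleftrightarrow>
     (\<forall>w'. (\<forall>n\<ge>1. w' n \<ge> w n) \<longrightarrow>
           (\<forall>A::nat \<Rightarrow> 'a. A \<in> Cc \<longrightarrow> A 0 = 0 \<longrightarrow> weighted_sum w' A \<le> energy lam A) \<longrightarrow>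
           (\<forall>n\<ge>1. w' n = w n))"

end

theory Submission imports Defs
begin

text \<open>
  With \<open>u\<^sub>n = n\<^sup>\<beta>\<close> the weight is the ground state weight of \<open>u\<close>: writing \<open>A = u \<phi>\<close>, the
  energy of \<open>A\<close> exceeds its weighted sum by exactly the sum of \<open>u\<^sub>n u\<^sub>n\<^sub>-\<^sub>1 (\<phi>\<^sub>n - \<phi>\<^sub>n\<^sub>-\<^sub>1)\<^sup>2 / \<lambda>\<^sub>n\<close>.
  The lower bound on the weight is pointwise and follows from \<open>2 - (1 - x)\<^sup>\<beta> - (1 + x)\<^sup>\<beta> > \<beta> (1 - \<beta>) x\<^sup>2\<close>.
  For optimality, \<open>u\<^sub>n u\<^sub>n\<^sub>-\<^sub>1 / \<lambda>\<^sub>n \<le> n\<close> when \<open>\<beta> \<le> 1/2\<close> and \<open>\<lambda>\<^sub>n \<ge> 1\<close>, so the logarithmic cutoff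
  \<open>\<phi>\<^sub>n = 1 - H\<^sub>n / H\<^sub>N\<close> (harmonic numbers) has remainder at most \<open>1 / H\<^sub>N\<close>, which tends to 0.
\<close>

section \<open>A strict power inequality and the pointwise lower bound on the weight\<close>

text \<open>The gap \<open>f\<close> between the two sides and its derivative \<open>g\<close> both
  vanish at 0, and \<open>g\<close> has a positive derivative on (0, 1). The endpoint
  \<open>x = 1\<close> has to be included because it is the case n = 1 of the weight.\<close>

lemma one_minus_powr_add_one_plus_powr_less:
  fixes b x :: real
  assumes b: "0 < b" "b < 1" and x: "0 < x" "x \<le> 1"
  shows "(1 - x) powr b + (1 + x) powr b + b * (1 - b) * x\<^sup>2 < 2"
proof -
  define g where "g t = b * (1 - t) powr (b - 1) - b * (1 + t) powr (b - 1) - 2 * b * (1 - b) * t"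
    for t :: real
  define f where "f t = 2 - (1 - t) powr b - (1 + t) powr b - b * (1 - b) * t\<^sup>2" for t :: real
  have g_pos: "g t > 0" if t: "0 < t" "t < 1" for t
  proof -
    have "g 0 < g t"
    proof (rule DERIV_pos_imp_increasing_open[OF t(1)])
      fix s :: real assume s: "0 < s" "s < t"
      define d where "d = b * (1 - b) * ((1 - s) powr (b - 2) + (1 + s) powr (b - 2) - 2)"
      have "(g has_real_derivative d) (at s)"
        unfolding g_def d_def using s t
        by (auto intro!: derivative_eq_intros simp: algebra_simps)
      moreover have "d > 0"
      proof -
        \<comment> \<open>\<open>p\<close> and \<open>q\<close> are square roots of the two powers
          in \<open>d\<close>. Since \<open>b / 2 - 1\<close> is negative and
          \<open>1 - s\<^sup>2\<close> lies in (0, 1), the product \<open>p * q\<close> exceeds 1,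
          so \<open>p\<^sup>2 + q\<^sup>2 \<ge> 2 * (p * q) > 2\<close>.\<close>
        define p where "p = (1 - s) powr (b / 2 - 1)"
        define q where "q = (1 + s) powr (b / 2 - 1)"
        have "(1 - s\<^sup>2) powr (b / 2 - 1) > 1"
        proof -
          have "1 - s\<^sup>2 > 0" "1 - s\<^sup>2 < 1"
            using s t abs_square_less_1[of s] by auto
          then have "(1 - s\<^sup>2) powr (b / 2 - 1) > (1 - s\<^sup>2) powr 0"
            using b by (intro powr_less_mono') auto
          then show ?thesis using \<open>1 - s\<^sup>2 > 0\<close> by simp
        qed
        moreover have "(1 - s\<^sup>2) powr (b / 2 - 1) = p * q"
          using s t by (simp add: p_def q_def flip: powr_mult) (simp add: algebra_simps power2_eq_square)
        moreover have "(1 - s) powr (b - 2) = p\<^sup>2" "(1 + s) powr (b - 2) = q\<^sup>2"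
          by (simp_all add: p_def q_def power2_eq_square flip: powr_add)
        moreover have "p\<^sup>2 + q\<^sup>2 \<ge> 2 * (p * q)"
          using sum_squares_bound[of p q] by simp
        ultimately show ?thesis
          using b by (simp add: d_def)
      qed
      ultimately show "\<exists>y. (g has_real_derivative y) (at s) \<and> y > 0" by blast
    next
      show "continuous_on {0..t} g"
        unfolding g_def using t by (intro continuous_intros) auto
    qed
    then show ?thesis by (simp add: g_def)
  qed
  have "f 0 < f x"
  proof (rule DERIV_pos_imp_increasing_open[OF x(1)])
    fix s :: real assume s: "0 < s" "s < x"
    have "(f has_real_derivative g s) (at s)"
      unfolding g_def f_def using s x
      by (auto intro!: derivative_eq_intros simp: algebra_simps)
    then show "\<exists>y. (f has_real_derivative y) (at s) \<and> y > 0"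
      using g_pos s x by force
  next
    \<comment> \<open>For \<open>x = 1\<close> the base \<open>1 - t\<close> reaches 0, where
      \<open>f\<close> need not be differentiable; continuity survives because the exponent is
      positive.\<close>
    show "continuous_on {0..x} f"
      unfolding f_def using x b by (intro continuous_intros continuous_on_powr') auto
  qed
  then show ?thesis by (simp add: f_def)
qed

text \<open>The weight is \<open>a * p - a' * q\<close>. The power inequality reads
  \<open>p - c > q + c\<close>, and \<open>q + c\<close> is positive. As \<open>lam\<close> is
  non-decreasing, \<open>a \<ge> a'\<close>, hence
  \<open>a * (p - c) \<ge> a' * (p - c) > a' * (q + c)\<close>; this rearranges to the
  claim.\<close>

lemma hardy_weight_gt:
  assumes b: "0 < \<beta>" "\<beta> < 1" and "mono_on {1..} lam" and pos: "\<forall>n\<ge>1. lam n > 0" and n: "n \<ge> 1"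
  shows "(1 / lam n + 1 / lam (n + 1)) * (\<beta> * (1 - \<beta>) / (2 * (real n)\<^sup>2)) < hardy_weight lam \<beta> n"
proof -
  define x where "x = 1 / real n"
  define a where "a = 1 / lam n"
  define a' where "a' = 1 / lam (n + 1)"
  define c where "c = \<beta> * (1 - \<beta>) / (2 * (real n)\<^sup>2)"
  define p where "p = 1 - (1 - x) powr \<beta>"
  define q where "q = (1 + x) powr \<beta> - 1"
  have x: "0 < x" "x \<le> 1" using n by (auto simp: x_def)
  have "lam n \<le> lam (n + 1)"
    using assms(3) n by (auto intro: mono_onD)
  then have a: "0 < a'" "a' \<le> a"
    using pos n by (auto simp: a_def a'_def intro!: divide_left_mono)
  have "2 * c = \<beta> * (1 - \<beta>) * x\<^sup>2"
    by (simp add: c_def x_def power_divide)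
  then have pq: "q + c < p - c"
    using one_minus_powr_add_one_plus_powr_less[OF b x] by (simp add: p_def q_def)
  have "q > 0" using gr_one_powr[of "1 + x" \<beta>] x b by (simp add: q_def)
  moreover have "c \<ge> 0" using b by (simp add: c_def)
  ultimately have "a' * (p - c) \<le> a * (p - c)"
    using a pq by (intro mult_right_mono) auto
  moreover have "a' * (q + c) < a' * (p - c)"
    using a pq by (intro mult_strict_left_mono) auto
  ultimately have "(a + a') * c < a * p - a' * q"
    by (simp add: algebra_simps)
  also have "a * p - a' * q = hardy_weight lam \<beta> n"
    by (simp add: hardy_weight_def a_def a'_def p_def q_def x_def right_diff_distrib)
  finally show ?thesis by (simp add: a_def a'_def c_def)
qed

section \<open>Reduction of the infinite sums to finite ones\<close>

lemma weighted_sum_eq_sum: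
  assumes "\<And>n. n > N \<Longrightarrow> A n = 0"
  shows "weighted_sum v A = (\<Sum>n=1..N. v n * (norm (A n))\<^sup>2)"
proof -
  have "weighted_sum v A = infsum (\<lambda>n. v n * (norm (A n))\<^sup>2) {1..N}"
    unfolding weighted_sum_def by (rule infsum_cong_neutral) (auto simp: assms)
  then show ?thesis by simp
qed

text \<open>Vanishing is required already at \<open>n = N\<close>, since the term with index
  \<open>N + 1\<close> involves \<open>A N\<close>.\<close>

lemma energy_eq_sum:
  assumes "\<And>n. n \<ge> N \<Longrightarrow> A n = 0"
  shows "energy lam A = (\<Sum>n=1..N. (norm (A n - A (n - 1)))\<^sup>2 / lam n)"
proof -
  have "energy lam A = infsum (\<lambda>n. (norm (A n - A (n - 1)))\<^sup>2 / lam n) {1..N}"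
    unfolding energy_def by (rule infsum_cong_neutral) (auto simp: assms)
  then show ?thesis by simp
qed

lemma Cc_vanishes_from:
  assumes "A \<in> Cc"
  obtains N where "\<And>n. n \<ge> N \<Longrightarrow> A n = 0"
proof -
  have "finite {n. A n \<noteq> 0}" using assms by (simp add: Cc_def)
  then obtain N where "\<forall>n\<in>{n. A n \<noteq> 0}. n < N"
    using finite_nat_set_iff_bounded by blast
  then show ?thesis using that[of N] by (auto simp: not_less[symmetric])
qed

section \<open>The ground state representation and the Hardy inequality\<close>

text \<open>With primes for index \<open>n - 1\<close>, each square splits as \<open>(u f - u' f')^2
  = u (u - u') f^2 + u' (u' - u) f'^2 + u u' (f - f')^2\<close>. Regrouping the first two terms by
  index leaves a boundary term at \<open>N\<close>; the one at 0 vanishes because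
  \<open>u 0 = 0\<close>.\<close>

lemma ground_state_identity:
  fixes a u f :: "nat \<Rightarrow> real"
  assumes "u 0 = 0"
  shows "(\<Sum>n=1..N. a n * (u n * f n - u (n - 1) * f (n - 1))\<^sup>2) =
    (\<Sum>n=1..N. (a n * (u n - u (n - 1)) + a (n + 1) * (u n - u (n + 1))) * u n * (f n)\<^sup>2)
    + (\<Sum>n=1..N. a n * u n * u (n - 1) * (f n - f (n - 1))\<^sup>2)
    + a (N + 1) * (u (N + 1) - u N) * u N * (f N)\<^sup>2"
proof (induction N)
  case 0
  then show ?case using assms by simp
next
  case (Suc N)
  then show ?case by (simp add: power2_eq_square algebra_simps)
qed

text \<open>Multiplication by \<open>u n\<close> turns the two powers into the neighbouring values
  of \<open>u\<close>. At \<open>n = 1\<close> the convention \<open>0 powr \<beta> = 0\<close>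
  agrees with \<open>u 0 = 0\<close>.\<close>

lemma hardy_weight_ground_state:
  fixes \<beta> :: real
  assumes "n \<ge> 1"
  defines "u \<equiv> \<lambda>n. real n powr \<beta>"
  shows "hardy_weight lam \<beta> n * (u n)\<^sup>2 =
    (1 / lam n * (u n - u (n - 1)) + 1 / lam (n + 1) * (u n - u (n + 1))) * u n"
proof -
  have shift: "(1 - 1 / real n) powr \<beta> * u n = u (n - 1)" "(1 + 1 / real n) powr \<beta> * u n = u (n + 1)"
  proof -
    have "1 - 1 / real n = real (n - 1) / real n" "1 + 1 / real n = real (n + 1) / real n"
      using assms(1) by (simp_all add: field_simps of_nat_diff)
    then show "(1 - 1 / real n) powr \<beta> * u n = u (n - 1)" "(1 + 1 / real n) powr \<beta> * u n = u (n + 1)"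
      using assms(1) by (simp_all only: u_def powr_divide of_nat_0_le_iff) simp_all
  qed
  then show ?thesis
    unfolding hardy_weight_def shift[symmetric] by (simp add: power2_eq_square algebra_simps)
qed

text \<open>This is the identity for \<open>a n = 1 / lam n\<close>; \<open>f N = 0\<close> removes
  the boundary term.\<close>

lemma energy_excess:
  fixes f :: "nat \<Rightarrow> real" and \<beta> :: real
  assumes "f N = 0"
  defines "u \<equiv> \<lambda>n. real n powr \<beta>"
  shows "(\<Sum>n=1..N. (u n * f n - u (n - 1) * f (n - 1))\<^sup>2 / lam n) =
    (\<Sum>n=1..N. hardy_weight lam \<beta> n * (u n * f n)\<^sup>2)
    + (\<Sum>n=1..N. u n * u (n - 1) * (f n - f (n - 1))\<^sup>2 / lam n)"
proof -
  have "(\<Sum>n=1..N. hardy_weight lam \<beta> n * (u n * f n)\<^sup>2) =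
    (\<Sum>n=1..N. (1 / lam n * (u n - u (n - 1)) + 1 / lam (n + 1) * (u n - u (n + 1))) * u n * (f n)\<^sup>2)"
    using hardy_weight_ground_state[of _ lam \<beta>]
    by (intro sum.cong) (auto simp: u_def power_mult_distrib simp flip: mult.assoc)
  then show ?thesis
    using ground_state_identity[of u "\<lambda>n. 1 / lam n" f N] assms(1) by (simp add: u_def)
qed

text \<open>The weighted sum depends only on \<open>norm (A n)\<close>, and passing to norms does
  not increase the energy, by the reverse triangle inequality. So the real identity suffices for
  every scalar field.\<close>

lemma weighted_sum_hardy_weight_le_energy:
  fixes A :: "nat \<Rightarrow> 'a::real_normed_field"
  assumes pos: "\<forall>n\<ge>1. lam n > 0" and A: "A \<in> Cc" "A 0 = 0"
  shows "weighted_sum (hardy_weight lam \<beta>) A \<le> energy lam A"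
proof -
  obtain N where N: "\<And>n. n \<ge> N \<Longrightarrow> A n = 0"
    using Cc_vanishes_from[OF A(1)] by blast
  define u where "u n = real n powr \<beta>" for n
  define f where "f n = norm (A n) / u n" for n
  have uf: "norm (A n) = u n * f n" for n
    using A(2) by (cases "n = 0") (auto simp: f_def u_def)
  have "weighted_sum (hardy_weight lam \<beta>) A = (\<Sum>n=1..N. hardy_weight lam \<beta> n * (u n * f n)\<^sup>2)"
    using N by (subst weighted_sum_eq_sum[of N]) (auto simp: uf)
  also have "\<dots> \<le> (\<Sum>n=1..N. hardy_weight lam \<beta> n * (u n * f n)\<^sup>2)
      + (\<Sum>n=1..N. u n * u (n - 1) * (f n - f (n - 1))\<^sup>2 / lam n)"
    using pos by (auto intro!: sum_nonneg divide_nonneg_pos simp: u_def)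
  also have "\<dots> = (\<Sum>n=1..N. (norm (A n) - norm (A (n - 1)))\<^sup>2 / lam n)"
    using energy_excess[of f N \<beta> lam, folded u_def] N[of N] by (simp add: uf f_def[of N])
  also have "\<dots> \<le> (\<Sum>n=1..N. (norm (A n - A (n - 1)))\<^sup>2 / lam n)"
  proof (intro sum_mono divide_right_mono)
    fix n
    show "(norm (A n) - norm (A (n - 1)))\<^sup>2 \<le> (norm (A n - A (n - 1)))\<^sup>2"
      using norm_triangle_ineq3[of "A n" "A (n - 1)"] by (simp add: abs_le_square_iff[symmetric])
  qed (use pos in \<open>auto intro: less_imp_le\<close>)
  also have "\<dots> = energy lam A"
    using N energy_eq_sum[of N A lam] by simp
  finally show ?thesis .
qed

lemma weighted_sum_strict_mono:
  fixes A :: "nat \<Rightarrow> 'a::real_normed_field"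
  assumes "\<And>n. n \<ge> 1 \<Longrightarrow> v n < w n" and A: "A \<in> Cc" "A 0 = 0" "A k \<noteq> 0"
  shows "weighted_sum v A < weighted_sum w A"
proof -
  obtain N where N: "\<And>n. n \<ge> N \<Longrightarrow> A n = 0"
    using Cc_vanishes_from[OF A(1)] by blast
  have k: "k \<in> {1..N}"
    using N[of k] A by (cases "k = 0"; cases "k \<le> N") auto
  have "(\<Sum>n=1..N. v n * (norm (A n))\<^sup>2) < (\<Sum>n=1..N. w n * (norm (A n))\<^sup>2)"
    using assms k
    by (intro sum_strict_mono_ex1) (auto intro!: mult_right_mono less_imp_le[OF assms(1)] bexI[of _ k])
  then show ?thesis using N by (simp add: weighted_sum_eq_sum[of N])
qed

section \<open>Optimality through logarithmic cutoffs\<close>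

lemma log_cutoff_remainder_le:
  fixes \<beta> :: real
  assumes lam: "\<forall>n\<ge>1. lam n \<ge> (1::real)" and b: "0 \<le> \<beta>" "\<beta> \<le> 1 / 2" and N: "N \<ge> 1"
  defines "u \<equiv> \<lambda>n. real n powr \<beta>" and "f \<equiv> \<lambda>n. 1 - harm (min n N) / harm N"
  shows "(\<Sum>n=1..N. u n * u (n - 1) * (f n - f (n - 1))\<^sup>2 / lam n) \<le> 1 / harm N"
proof -
  have h: "harm N > (0::real)" using N by (simp add: harm_pos)
  \<comment> \<open>The increment of \<open>f\<close> at \<open>n\<close> is
    \<open>- 1 / (n * harm N)\<close>, so a coefficient of at most \<open>n\<close> leaves
    \<open>1 / n\<close> times a constant, and these sum to a harmonic number again.\<close>
  have "(\<Sum>n=1..N. u n * u (n - 1) * (f n - f (n - 1))\<^sup>2 / lam n) \<le>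
      (\<Sum>n=1..N. inverse (real n) * (1 / (harm N)\<^sup>2))"
  proof (rule sum_mono)
    fix n assume n: "n \<in> {1..N}"
    then obtain m where m: "n = Suc m" by (cases n) auto
    have "f n - f (n - 1) = - (1 / (real n * harm N))"
      using n h unfolding f_def m by (simp add: min_def harm_Suc add_divide_distrib inverse_eq_divide)
    then have sq: "(f n - f (n - 1))\<^sup>2 = (1 / real n)\<^sup>2 * (1 / (harm N)\<^sup>2)"
      by (simp add: power_divide power_mult_distrib)
    have "u n * u (n - 1) \<le> u n * u n"
      using b by (auto simp: u_def intro!: mult_left_mono powr_mono2)
    also have "\<dots> = real n powr (2 * \<beta>)"
      by (simp add: u_def flip: powr_add)
    also have "\<dots> \<le> real n powr 1"
      using n b by (intro powr_mono) auto
    finally have "u n * u (n - 1) \<le> real n" using n by simp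
    then have "u n * u (n - 1) * (f n - f (n - 1))\<^sup>2 / lam n \<le> real n * (f n - f (n - 1))\<^sup>2 / 1"
      using lam n by (intro frac_le mult_right_mono) auto
    also have "\<dots> = inverse (real n) * (1 / (harm N)\<^sup>2)"
      unfolding sq using n by (simp add: power2_eq_square inverse_eq_divide)
    finally show "u n * u (n - 1) * (f n - f (n - 1))\<^sup>2 / lam n \<le> inverse (real n) * (1 / (harm N)\<^sup>2)" .
  qed
  also have "\<dots> = harm N * (1 / (harm N)\<^sup>2)"
    by (simp only: harm_def sum_distrib_right)
  also have "\<dots> = 1 / harm N"
    using h by (simp add: power2_eq_square)
  finally show ?thesis .
qed

text \<open>Testing a competitor \<open>w'\<close> on \<open>u n * F N n\<close> bounds the weighted
  sum of its excess \<open>e\<close> by the cutoff remainder. As \<open>N\<close> grows,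
  \<open>F N k\<close> tends to 1 and the remainder to 0, which forces
  \<open>e k \<le> 0\<close>.\<close>

lemma optimal_weight_hardy_weight:
  assumes lam: "\<forall>n\<ge>1. lam n \<ge> 1" and b: "0 \<le> \<beta>" "\<beta> \<le> 1 / 2"
  shows "optimal_weight TYPE('a::real_normed_field) lam (hardy_weight lam \<beta>)"
  unfolding optimal_weight_def
proof (intro allI impI)
  fix w' k
  assume ge: "\<forall>n\<ge>1. hardy_weight lam \<beta> n \<le> w' n"
    and le: "\<forall>A::nat \<Rightarrow> 'a. A \<in> Cc \<longrightarrow> A 0 = 0 \<longrightarrow> weighted_sum w' A \<le> energy lam A"
    and k: "1 \<le> (k::nat)"
  define u where "u n = real n powr \<beta>" for n
  define e where "e n = w' n - hardy_weight lam \<beta> n" for n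
  define F where "F N n = (1 - harm (min n N) / harm N :: real)" for N n
  have bound: "e k * (u k * F N k)\<^sup>2 \<le> 1 / harm N" if N: "N \<ge> k" for N
  proof -
    have "harm N \<noteq> (0::real)"
      using N k by (intro less_imp_neq[OF harm_pos, symmetric]) linarith
    define f where "f = F N"
    have f0: "f n = 0" if "n \<ge> N" for n
      using that \<open>harm N \<noteq> 0\<close> by (simp add: f_def F_def min_def)
    define A where "A n = (of_real (u n * f n) :: 'a)" for n
    have A0: "A n = 0" if "n \<ge> N" for n
      using f0[OF that] by (simp add: A_def)
    have norm_A: "norm (A n) = \<bar>u n * f n\<bar>" "norm (A n - A m) = \<bar>u n * f n - u m * f m\<bar>" for n m
      unfolding A_def of_real_diff[symmetric] by (simp_all only: norm_of_real)
    have "{n. A n \<noteq> 0} \<subseteq> {..<N}" using A0 by (force simp: not_le[symmetric])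
    then have "A \<in> Cc" by (auto simp: Cc_def intro: finite_subset)
    then have "weighted_sum w' A \<le> energy lam A"
      using le by (simp add: A_def u_def)
    moreover have "weighted_sum w' A = (\<Sum>n=1..N. w' n * (u n * f n)\<^sup>2)"
      using A0 by (subst weighted_sum_eq_sum[of N]) (auto simp: norm_A)
    moreover have "energy lam A = (\<Sum>n=1..N. (u n * f n - u (n - 1) * f (n - 1))\<^sup>2 / lam n)"
      using A0 by (subst energy_eq_sum[of N]) (auto simp: norm_A)
    moreover have "\<dots> = (\<Sum>n=1..N. hardy_weight lam \<beta> n * (u n * f n)\<^sup>2)
        + (\<Sum>n=1..N. u n * u (n - 1) * (f n - f (n - 1))\<^sup>2 / lam n)"
      using energy_excess[of f N \<beta> lam] f0[of N] by (simp add: u_def)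
    moreover have "(\<Sum>n=1..N. u n * u (n - 1) * (f n - f (n - 1))\<^sup>2 / lam n) \<le> 1 / harm N"
      using log_cutoff_remainder_le[OF lam b, of N] N k by (simp add: u_def f_def F_def)
    ultimately have "(\<Sum>n=1..N. e n * (u n * f n)\<^sup>2) \<le> 1 / harm N"
      by (simp add: e_def left_diff_distrib sum_subtractf)
    \<comment> \<open>All summands are nonnegative because \<open>w'\<close> dominates the weight,
      so the one at \<open>k\<close> can be isolated.\<close>
    moreover have "e k * (u k * f k)\<^sup>2 \<le> (\<Sum>n=1..N. e n * (u n * f n)\<^sup>2)"
      using ge k N by (intro member_le_sum) (auto simp: e_def)
    ultimately show ?thesis by (simp add: f_def)
  qed
  have lim: "(\<lambda>N. c / harm N :: real) \<longlonglongrightarrow> 0" for c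
    by (intro tendsto_divide_0[OF tendsto_const] filterlim_at_top_imp_at_infinity harm_at_top)
  have "(\<lambda>N. 1 - harm k / harm N) \<longlonglongrightarrow> (1 - 0 :: real)"
    by (intro tendsto_intros lim)
  moreover have "\<forall>\<^sub>F N in sequentially. 1 - harm k / harm N = F N k"
    using eventually_ge_at_top[of k] by eventually_elim (simp add: F_def min_def)
  ultimately have "(\<lambda>N. F N k) \<longlonglongrightarrow> 1"
    using Lim_transform_eventually by fastforce
  then have "(\<lambda>N. e k * (u k * F N k)\<^sup>2) \<longlonglongrightarrow> e k * (u k * 1)\<^sup>2"
    by (intro tendsto_intros)
  then have "e k * (u k * 1)\<^sup>2 \<le> 0"
    by (rule tendsto_le[OF sequentially_bot lim[of 1]])
       (rule eventually_mono[OF eventually_ge_at_top bound])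
  moreover have "u k > 0" using k by (simp add: u_def)
  ultimately have "e k \<le> 0" by (simp add: mult_le_0_iff)
  then show "w' k = hardy_weight lam \<beta> k"
    using ge k by (force simp: e_def)
qed

section \<open>The strict lower bound for sums and the full statement\<close>

lemma weighted_sum_less_weighted_sum_hardy_weight:
  fixes A :: "nat \<Rightarrow> 'a::real_normed_field"
  assumes "0 < \<beta>" "\<beta> < 1" "mono_on {1..} lam" "\<forall>n\<ge>1. lam n > 0"
    and A: "A \<in> Cc" "A 0 = 0" "\<exists>n. A n \<noteq> 0"
  shows "weighted_sum (\<lambda>n. (1 / lam n + 1 / lam (n + 1)) * (\<beta> * (1 - \<beta>) / (2 * (real n)\<^sup>2))) A
      < weighted_sum (hardy_weight lam \<beta>) A"
proof -
  obtain k where "A k \<noteq> 0" using A(3) by blast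
  show ?thesis
    by (rule weighted_sum_strict_mono[OF _ A(1,2) \<open>A k \<noteq> 0\<close>]) (rule hardy_weight_gt[OF assms(1-4)])
qed

theorem theorem2p5:
  fixes lam :: "nat \<Rightarrow> real" and \<beta> :: real
  assumes "0 < \<beta>" and "\<beta> < 1"
    and "mono_on {1..} lam"
    and "\<forall>n\<ge>1. lam n > 0"
  shows "(\<forall>A::nat \<Rightarrow> real. A \<in> Cc \<longrightarrow> A 0 = 0 \<longrightarrow> (\<exists>n. A n \<noteq> 0) \<longrightarrow>
            weighted_sum (\<lambda>n. (1 / lam n + 1 / lam (n + 1)) * (\<beta> * (1 - \<beta>) / (2 * (real n)\<^sup>2))) A
              < weighted_sum (hardy_weight lam \<beta>) A
            \<and> weighted_sum (hardy_weight lam \<beta>) A \<le> energy lam A)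
       \<and> (\<forall>A::nat \<Rightarrow> complex. A \<in> Cc \<longrightarrow> A 0 = 0 \<longrightarrow> (\<exists>n. A n \<noteq> 0) \<longrightarrow>
            weighted_sum (\<lambda>n. (1 / lam n + 1 / lam (n + 1)) * (\<beta> * (1 - \<beta>) / (2 * (real n)\<^sup>2))) A
              < weighted_sum (hardy_weight lam \<beta>) A
            \<and> weighted_sum (hardy_weight lam \<beta>) A \<le> energy lam A)
       \<and> ((\<forall>n\<ge>1. lam n \<ge> 1) \<and> \<beta> \<le> 1 / 2 \<longrightarrow>
            optimal_weight TYPE(real) lam (hardy_weight lam \<beta>)
            \<and> optimal_weight TYPE(complex) lam (hardy_weight lam \<beta>))"
  by (intro conjI allI impI weighted_sum_less_weighted_sum_hardy_weight[OF assms]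
      weighted_sum_hardy_weight_le_energy[OF assms(4)] optimal_weight_hardy_weight)
    (use assms(1) in simp_all)

end
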